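(* Let $f$ be a procurement cost function satisfying (F1)–(F4) and let $f_s$ be a surrogate function satisfying (S1)–(S5). Define $$\alpha_{f,f_s}:=\sup_{\mathbf 0\preceq \mathbf u\preceq T\mathbf 1}\frac{f^*(\nabla f_s(\mathbf u))}{f_s(\mathbf u)-f(\mathbf u)}.$$ Then the Simultaneous Update algorithm called with $f_s$ has competitive ratio at least $1/\alpha_{f,f_s}$; that is, for all $v_1,\dots,v_T$ satisfying (V1)–(V3), the decisions $\bar{\mathbf x}_1,\dots,\bar{\mathbf x}_T$ of the algorithm satisfy $$\sum_{t=1}^T v_t(\bar{\mathbf x}_t)-f\Big(\sum_{t=1}^T\bar{\mathbf x}_t\Big)\ \ge\ \frac{1}{\alpha_{f,f_s}}\,P^\star .$$
   Context: Fix integers $D,T\ge 1$. Vector inequalities $\succeq,\preceq$ are componentwise; $\mathbf 0,\mathbf 1\in\mathbb R^D$ are the all-zeros and all-ones vectors. A function is closed if its sublevel sets are closed (superlevel sets, for a concave function). Payment functions $v_t:\mathbb R_+^D\to\mathbb R_+$, $t=1,\dots,T$, satisfy: (V1) $v_t$ is concave, differentiable and closed; (V2) $\mathbf u\succeq\mathbf v$ implies $v_t(\mathbf u)\ge v_t(\mathbf v)$; (V3) $v_t(\mathbf 0)=0$. The procurement cost $f:\mathbb R_+^D\to\mathbb R_+$ satisfies: (F1) $f$ is convex, differentiable and closed; (F2) $\mathbf u\succeq\mathbf v$ implies $f(\mathbf u)\ge f(\mathbf v)$; (F3) $\mathbf u\succeq\mathbf v$ implies $\nabla f(\mathbf u)\succeq\nabla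 f(\mathbf v)$; (F4) $f(\mathbf 0)=0$. The surrogate $f_s:\mathbb R_+^D\to\mathbb R_+$ satisfies: (S1) $f_s$ is convex, differentiable and closed; (S2) $\mathbf u\succeq\mathbf v$ implies $f_s(\mathbf u)\ge f_s(\mathbf v)$; (S3) $\mathbf u\succeq\mathbf v$ implies $\nabla f_s(\mathbf u)\succeq\nabla f_s(\mathbf v)$; (S4) $f_s(\mathbf 0)=0$; (S5) $f_s(\mathbf u)\ge f(\mathbf u)$ for all $\mathbf 0\preceq\mathbf u\preceq T\mathbf 1$. Offline optimum: $P^\star:=\max\{\sum_{t=1}^T v_t(\mathbf x_t)-f(\sum_{t=1}^T\mathbf x_t): \mathbf x_t\in[0,1]^D\text{ for all }t\}$. Conjugates: $f^*(\boldsymbol\lambda)=\sup_{\mathbf u\in\mathbb R_+^D}\{\boldsymbol\lambda^\top\mathbf u-f(\mathbf u)\}$ (value in $(-\infty,+\infty]$), similarly $f_s^*$; concave conjugate $v_{t*}(\mathbf z)=\inf_{\mathbf u\in\mathbb R_+^D}\{\mathbf z^\top\mathbf u-v_t(\mathbf u)\}$. Simultaneous Update algorithm called with $f_s$: for $t=1,\dots,T$, after $v_t$ is revealed and given $\bar{\mathbf x}_1,\dots,\bar{\mathbf x}_{t-1}$, it takes $(\bar{\boldsymbol\lambda}_t,\bar{\mathbf z}_t,\bar{\mathbf x}_t)$ to be a saddle point of $$\min_{\boldsymbol\lambda\succeq\mathbf 0,\ \mathbf z\succeq\mathbf 0}\ \max_{\mathbf 0\preceq\mathbf x\preceq\mathbf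 1}\ \mathbf z^\top\mathbf x-v_{t*}(\mathbf z)-\boldsymbol\lambda^\top\Big(\sum_{i=1}^{t-1}\bar{\mathbf x}_i+\mathbf x\Big)+f_s^*(\boldsymbol\lambda),$$ with $\bar{\boldsymbol\lambda}_t=\nabla f_s(\sum_{i=1}^t\bar{\mathbf x}_i)$ and $\bar{\mathbf z}_t=\nabla v_t(\bar{\mathbf x}_t)$. In particular $\bar{\mathbf x}_t$ maximizes $(\bar{\mathbf z}_t-\bar{\boldsymbol\lambda}_t)^\top\mathbf x$ over $\mathbf 0\preceq\mathbf x\preceq\mathbf 1$. In the definition of $\alpha_{f,f_s}$, a ratio $c/0$ with $c>0$ is $+\infty$ and $0/0$ is read as $1$; $1/\infty=0$. *)

theory Defs
  imports "HOL-Analysis.Analysis"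
begin

text \<open>
  The dimension \<open>D\<close> is the cardinality of the index type \<open>'d\<close>, and \<open>\<le>\<close>, \<open>0\<close>, \<open>1\<close>,
  \<open>{a..b}\<close> on \<^typ>\<open>real ^ 'd\<close> are componentwise.  A function on the nonnegative orthant is
  a total function whose values outside the orthant are never used.
\<close>

definition orthant :: "(real ^ 'd) set" where
  "orthant = {u. 0 \<le> u}"

text \<open>
  Derivatives are taken within the orthant, so they also make sense at boundary points, where
  the gradient is still unique (\<open>grad_eqI\<close> below).
\<close>

definition grad :: "(real ^ 'd \<Rightarrow> real) \<Rightarrow> real ^ 'd \<Rightarrow> real ^ 'd" where
  "grad f u = (THE g. (f has_derivative (\<lambda>h. g \<bullet> h)) (at u within orthant))"

definition payment_function :: "(real ^ 'd \<Rightarrow> real) \<Rightarrow> bool" where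
  "payment_function v \<longleftrightarrow>
     (\<forall>u\<in>orthant. 0 \<le> v u) \<and>
     concave_on orthant v \<and> v differentiable_on orthant \<and>
     (\<forall>c. closed {u \<in> orthant. c \<le> v u}) \<and>
     (\<forall>u\<in>orthant. \<forall>w\<in>orthant. w \<le> u \<longrightarrow> v w \<le> v u) \<and>
     v 0 = 0"

definition procurement_cost :: "(real ^ 'd \<Rightarrow> real) \<Rightarrow> bool" where
  "procurement_cost f \<longleftrightarrow>
     (\<forall>u\<in>orthant. 0 \<le> f u) \<and>
     convex_on orthant f \<and> f differentiable_on orthant \<and>
     (\<forall>c. closed {u \<in> orthant. f u \<le> c}) \<and>
     (\<forall>u\<in>orthant. \<forall>w\<in>orthant. w \<le> u \<longrightarrow> f w \<le> f u) \<and>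
     (\<forall>u\<in>orthant. \<forall>w\<in>orthant. w \<le> u \<longrightarrow> grad f w \<le> grad f u) \<and>
     f 0 = 0"

text \<open>The conditions (S1)--(S4) on a surrogate coincide with (F1)--(F4).\<close>

definition surrogate :: "nat \<Rightarrow> (real ^ 'd \<Rightarrow> real) \<Rightarrow> (real ^ 'd \<Rightarrow> real) \<Rightarrow> bool" where
  "surrogate T f f\<^sub>s \<longleftrightarrow>
     procurement_cost f\<^sub>s \<and> (\<forall>u \<in> {0..real T *\<^sub>R 1}. f u \<le> f\<^sub>s u)"

definition welfare ::
  "nat \<Rightarrow> (nat \<Rightarrow> real ^ 'd \<Rightarrow> real) \<Rightarrow> (real ^ 'd \<Rightarrow> real) \<Rightarrow> (nat \<Rightarrow> real ^ 'd) \<Rightarrow> real" where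
  "welfare T v f x = (\<Sum>t=1..T. v t (x t)) - f (\<Sum>t=1..T. x t)"

text \<open>The supremum is a maximum, see \<open>offline_opt_attained\<close> below.\<close>

definition offline_opt ::
  "nat \<Rightarrow> (nat \<Rightarrow> real ^ 'd \<Rightarrow> real) \<Rightarrow> (real ^ 'd \<Rightarrow> real) \<Rightarrow> ereal" where
  "offline_opt T v f = (SUP x \<in> {x. \<forall>t\<in>{1..T}. x t \<in> {0..1}}. ereal (welfare T v f x))"

definition conjugate :: "(real ^ 'd \<Rightarrow> real) \<Rightarrow> real ^ 'd \<Rightarrow> ereal" where
  "conjugate f l = (SUP u\<in>orthant. ereal (l \<bullet> u - f u))"

definition concave_conjugate :: "(real ^ 'd \<Rightarrow> real) \<Rightarrow> real ^ 'd \<Rightarrow> ereal" where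
  "concave_conjugate v z = (INF u\<in>orthant. ereal (z \<bullet> u - v u))"

text \<open>\<open>(p, x)\<close> is a saddle point of \<open>min\<close> over \<open>P\<close>, \<open>max\<close> over \<open>X\<close> of \<open>L\<close>.\<close>

definition saddle_point ::
  "'p set \<Rightarrow> 'x set \<Rightarrow> ('p \<Rightarrow> 'x \<Rightarrow> ereal) \<Rightarrow> 'p \<Rightarrow> 'x \<Rightarrow> bool" where
  "saddle_point P X L p x \<longleftrightarrow>
     p \<in> P \<and> x \<in> X \<and> (\<forall>y\<in>X. L p y \<le> L p x) \<and> (\<forall>q\<in>P. L p x \<le> L q x)"

text \<open>
  Since \<open>v 0 = 0\<close> and \<open>f\<^sub>s 0 = 0\<close>, the concave conjugate is never \<open>\<infinity>\<close> and the conjugate never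
  \<open>-\<infinity>\<close>, so no indeterminate \<open>\<infinity> - \<infinity>\<close> occurs.
\<close>

definition su_lagrangian ::
  "(real ^ 'd \<Rightarrow> real) \<Rightarrow> (real ^ 'd \<Rightarrow> real) \<Rightarrow> real ^ 'd \<Rightarrow>
     (real ^ 'd) \<times> (real ^ 'd) \<Rightarrow> real ^ 'd \<Rightarrow> ereal" where
  "su_lagrangian f\<^sub>s v s = (\<lambda>(l, z) x.
     ereal (z \<bullet> x) - concave_conjugate v z - ereal (l \<bullet> (s + x)) + conjugate f\<^sub>s l)"

text \<open>
  \<open>l\<close>, \<open>z\<close>, \<open>x\<close> is a possible run of the algorithm called with \<open>f\<^sub>s\<close>.  Saddle points need not
  be unique, so this is a relation.
\<close>

definition simultaneous_update ::
  "nat \<Rightarrow> (real ^ 'd \<Rightarrow> real) \<Rightarrow> (nat \<Rightarrow> real ^ 'd \<Rightarrow> real) \<Rightarrow>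
     (nat \<Rightarrow> real ^ 'd) \<Rightarrow> (nat \<Rightarrow> real ^ 'd) \<Rightarrow> (nat \<Rightarrow> real ^ 'd) \<Rightarrow> bool" where
  "simultaneous_update T f\<^sub>s v l z x \<longleftrightarrow>
     (\<forall>t\<in>{1..T}.
        saddle_point ({0..} \<times> {0..}) {0..1} (su_lagrangian f\<^sub>s (v t) (\<Sum>i=1..<t. x i))
          (l t, z t) (x t) \<and>
        l t = grad f\<^sub>s (\<Sum>i=1..t. x i) \<and>
        z t = grad (v t) (x t))"

text \<open>In \<^typ>\<open>ereal\<close>, \<open>c / 0 = \<infinity>\<close> for \<open>c > 0\<close> and \<open>1 / \<infinity> = 0\<close>, but \<open>0 / 0 = 0\<close>.\<close>

definition ratio :: "ereal \<Rightarrow> ereal \<Rightarrow> ereal" where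
  "ratio a b = (if a = 0 \<and> b = 0 then 1 else a / b)"

definition alpha :: "nat \<Rightarrow> (real ^ 'd \<Rightarrow> real) \<Rightarrow> (real ^ 'd \<Rightarrow> real) \<Rightarrow> ereal" where
  "alpha T f f\<^sub>s =
     (SUP u \<in> {0..real T *\<^sub>R 1}. ratio (conjugate f (grad f\<^sub>s u)) (ereal (f\<^sub>s u - f u)))"

lemma ratio_conventions:
  "ratio 0 0 = 1" "0 < c \<Longrightarrow> ratio c 0 = \<infinity>" "(1::ereal) / \<infinity> = 0"
  by (auto simp: ratio_def divide_ereal_def)

lemma grad_eqI:
  assumes "u \<in> orthant" and g: "(f has_derivative (\<lambda>h. g \<bullet> h)) (at u within orthant)"
  shows "grad f u = g"
  unfolding grad_def
proof (rule the_equality, rule g)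
  fix g' assume g': "(f has_derivative (\<lambda>h. g' \<bullet> h)) (at u within orthant)"
  have "(\<lambda>h. g' \<bullet> h) = (\<lambda>h. g \<bullet> h)"
  proof (rule frechet_derivative_unique_within[OF g' g])
    fix i :: "real ^ 'a" and e :: real
    assume i: "i \<in> Basis" and e: "0 < e"
    have "0 \<le> i" using i by (auto simp: Basis_vec_def less_eq_vec_def axis_def)
    then have "u + (e/2) *\<^sub>R i \<in> orthant"
      using \<open>u \<in> orthant\<close> e by (auto simp: orthant_def less_eq_vec_def)
    then show "\<exists>d. 0 < \<bar>d\<bar> \<and> \<bar>d\<bar> < e \<and> u + d *\<^sub>R i \<in> orthant"
      using e by (intro exI[of _ "e/2"]) auto
  qed
  then show "g' = g" by (metis vector_eq_rdot)
qed

lemma has_derivative_grad: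
  assumes "u \<in> orthant" and "f differentiable_on orthant"
  shows "(f has_derivative (\<lambda>h. grad f u \<bullet> h)) (at u within orthant)"
proof -
  obtain f' where f': "(f has_derivative f') (at u within orthant)"
    using assms by (auto simp: differentiable_on_def differentiable_def)
  then have lin: "linear f'" by (metis has_derivative_linear)
  have "f' = (\<lambda>h. adjoint f' 1 \<bullet> h)"
    using adjoint_works[OF lin, of _ 1] by (auto simp: inner_commute fun_eq_iff)
  with f' have "(f has_derivative (\<lambda>h. adjoint f' 1 \<bullet> h)) (at u within orthant)" by simp
  with grad_eqI[OF assms(1) this] show ?thesis by simp
qed

lemma offline_opt_attained:
  fixes f :: "real ^ 'd \<Rightarrow> real"
  assumes "\<And>t. t \<in> {1..T} \<Longrightarrow> payment_function (v t)" and "procurement_cost f"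
  shows "\<exists>x. (\<forall>t\<in>{1..T}. x t \<in> {0..1}) \<and> offline_opt T v f = ereal (welfare T v f x)"
proof -
  define X where "X = Pi\<^sub>E UNIV (\<lambda>t. if t \<in> {1..T} then {0..1::real ^ 'd} else {0})"
  have X: "x t \<in> {0..1}" if "x \<in> X" "t \<in> {1..T}" for x t
    using that unfolding X_def PiE_def Pi_def by (metis (mono_tags, lifting) IntD1 UNIV_I mem_Collect_eq)
  have "compactin (product_topology (\<lambda>t::nat. euclidean :: (real ^ 'd) topology) UNIV) X"
    unfolding X_def by (subst compactin_PiE) (auto simp: interval_cbox)
  then have cpt: "compact X" by (simp add: euclidean_product_topology)
  have ne: "X \<noteq> {}" by (auto simp: X_def PiE_eq_empty_iff less_eq_vec_def)
  have cf: "continuous_on orthant f"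
    using assms(2) by (auto simp: procurement_cost_def intro: differentiable_imp_continuous_on)
  have cv: "continuous_on orthant (v t)" if "t \<in> {1..T}" for t
    using assms(1)[OF that] by (auto simp: payment_function_def intro: differentiable_imp_continuous_on)
  have cx: "continuous_on X (\<lambda>x. x t)" for t
    by (rule continuous_on_subset[OF continuous_on_product_coordinates]) auto
  have "continuous_on X (\<lambda>x. v t (x t))" if "t \<in> {1..T}" for t
    by (rule continuous_on_compose2[OF cv[OF that] cx]) (use X that in \<open>auto simp: orthant_def\<close>)
  moreover have "continuous_on X (\<lambda>x. f (\<Sum>t=1..T. x t))"
  proof (rule continuous_on_compose2[OF cf])
    show "(\<lambda>x. \<Sum>t=1..T. x t) ` X \<subseteq> orthant"
      unfolding orthant_def using X by (auto simp del: atLeastAtMost_iff intro!: sum_nonneg) auto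
  qed (intro continuous_on_sum cx)
  ultimately have "continuous_on X (welfare T v f)"
    unfolding welfare_def by (intro continuous_intros) auto
  from continuous_attains_sup[OF cpt ne this]
  obtain x where x: "x \<in> X" and mx: "\<And>y. y \<in> X \<Longrightarrow> welfare T v f y \<le> welfare T v f x" by blast
  have "offline_opt T v f = ereal (welfare T v f x)"
    unfolding offline_opt_def
  proof (rule antisym)
    show "(SUP x\<in>{x. \<forall>t\<in>{1..T}. x t \<in> {0..1}}. ereal (welfare T v f x)) \<le> ereal (welfare T v f x)"
    proof (rule SUP_least)
      fix y assume y: "y \<in> {x. \<forall>t\<in>{1..T}. x t \<in> {0..1 :: real ^ 'd}}"
      let ?y = "\<lambda>t. if t \<in> {1..T} then y t else 0"
      have "?y \<in> X" using y by (auto simp: X_def)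
      moreover have "welfare T v f ?y = welfare T v f y" by (simp add: welfare_def)
      ultimately show "ereal (welfare T v f y) \<le> ereal (welfare T v f x)"
        using mx by (metis ereal_less_eq(3))
    qed
  qed (rule SUP_upper, use X[OF x] in auto)
  with X[OF x] show ?thesis by blast
qed

end

theory Submission
  imports Defs
begin

text \<open>
  The proof is a primal--dual argument.  The algorithm acts as if item bundles were sold at
  posted marginal prices: at time \<open>t\<close> the price is \<open>l t = \<nabla>f\<^sub>s (x 1 + \<dots> + x t)\<close> and, by the saddle
  point property, \<open>x t\<close> is a best response in the box to the linearised payment \<open>z t\<close> at this
  price (\<open>simultaneous_update_best_response\<close>).  Convexity of \<open>f\<^sub>s\<close> makes the revenue
  \<open>\<Sum> l t \<bullet> x t\<close> collected in this way at least \<open>f\<^sub>s U\<close>, where \<open>U = \<Sum> x t\<close>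
  (\<open>cost_le_marginal_revenue\<close>).

  Let \<open>B = \<Sum> v t (x t) - f\<^sub>s U\<close> be the welfare measured with the surrogate cost, so that the
  true welfare is \<open>A = B + (f\<^sub>s U - f U)\<close>.  Comparing the best response with \<open>0\<close> gives
  \<open>B \<ge> 0\<close> (\<open>surrogate_welfare_nonneg\<close>).  For an arbitrary offline solution \<open>y\<close>, linearise each
  \<open>v t\<close> at \<open>x t\<close>, charge \<open>y\<close> the final price \<open>\<nabla>f\<^sub>s U\<close>, and bound what remains of the cost by
  the conjugate.  Final prices dominate earlier ones because \<open>\<nabla>f\<^sub>s\<close> is monotone, so the best
  responses \<open>x t\<close> beat \<open>y t\<close>, and weak duality yields
  \<open>P\<^sup>\<star> \<le> B + f\<^sup>* (\<nabla>f\<^sub>s U)\<close> (\<open>welfare_le_surrogate_welfare_plus_conjugate\<close>).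
  By definition of \<open>\<alpha>\<close> the last term is at most \<open>\<alpha> (f\<^sub>s U - f U) = \<alpha> (A - B)\<close>; since
  \<open>\<alpha> \<ge> 1\<close> and \<open>B \<ge> 0\<close>, altogether \<open>P\<^sup>\<star> \<le> B + \<alpha> (A - B) \<le> \<alpha> A\<close>.
\<close>

section \<open>Gradients and conjugates on the orthant\<close>

text \<open>
  The chord slopes \<open>(f (u + t (w - u)) - f u) / t\<close> are bounded by \<open>f w - f u\<close>, hence so is their
  limit \<open>f' (w - u)\<close> as \<open>t\<close> decreases to \<open>0\<close>.  Only a one-sided limit along a segment in \<open>S\<close> is
  taken, so \<open>u\<close> may lie on the boundary of \<open>S\<close>.
\<close>

lemma convex_on_above_tangent_within:
  fixes f :: "'a::real_normed_vector \<Rightarrow> real"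
  assumes conv: "convex_on S f" and f': "(f has_derivative f') (at u within S)"
    and u: "u \<in> S" and w: "w \<in> S"
  shows "f u + f' (w - u) \<le> f w"
proof -
  let ?p = "\<lambda>t::real. u + t *\<^sub>R (w - u)"
  have mem: "?p t \<in> S" and chord: "f (?p t) \<le> f u + t * (f w - f u)" if "t \<in> {0..1}" for t
  proof -
    have eq: "?p t = (1 - t) *\<^sub>R u + t *\<^sub>R w" by (simp add: algebra_simps)
    show "?p t \<in> S"
      unfolding eq by (rule convexD) (use conv u w that in \<open>auto simp: convex_on_def\<close>)
    show "f (?p t) \<le> f u + t * (f w - f u)"
      using convex_onD[OF conv, of t u w] u w that unfolding eq by (simp add: algebra_simps)
  qed
  have "?p ` {0..1} \<subseteq> S" using mem by blast
  then have "(f has_derivative f') (at (?p 0) within ?p ` {0..1})"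
    using has_derivative_subset[OF f'] by simp
  moreover have "(?p has_derivative (\<lambda>t. t *\<^sub>R (w - u))) (at 0 within {0..1})"
    by (auto intro!: derivative_eq_intros)
  ultimately have "((\<lambda>t. f (?p t)) has_derivative (\<lambda>t. f' (t *\<^sub>R (w - u)))) (at 0 within {0..1})"
    by (rule has_derivative_in_compose[rotated])
  moreover have "(\<lambda>t. f' (t *\<^sub>R (w - u))) = (*) (f' (w - u))"
    using has_derivative_linear[OF f'] by (auto simp: linear_scale)
  ultimately have "((\<lambda>t. f (?p t)) has_field_derivative f' (w - u)) (at 0 within {0..1})"
    by (simp add: has_field_derivative_def)
  then have "((\<lambda>t. (f (?p t) - f u) / t) \<longlongrightarrow> f' (w - u)) (at 0 within {0..1})"
    by (simp add: has_field_derivative_iff)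
  moreover have "\<forall>\<^sub>F t in at 0 within {0..1}. (f (?p t) - f u) / t \<le> f w - f u"
    using chord by (fastforce simp: eventually_at_filter field_simps)
  moreover have "at (0::real) within {0..1} \<noteq> bot"
    by (simp add: at_within_Icc_at_right)
  ultimately have "f' (w - u) \<le> f w - f u" by (rule tendsto_upperbound)
  then show ?thesis by simp
qed

lemma convex_above_grad:
  assumes "convex_on orthant f" and "f differentiable_on orthant"
    and "u \<in> orthant" and "w \<in> orthant"
  shows "f u + grad f u \<bullet> (w - u) \<le> f w"
  using convex_on_above_tangent_within[OF assms(1) has_derivative_grad] assms by blast

lemma concave_below_grad:
  assumes "concave_on orthant v" and "v differentiable_on orthant"
    and "u \<in> orthant" and "w \<in> orthant"
  shows "v w \<le> v u + grad v u \<bullet> (w - u)"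
proof -
  have "- v u + - (grad v u \<bullet> (w - u)) \<le> - v w"
    by (rule convex_on_above_tangent_within[where S = orthant])
      (use assms in \<open>auto simp: concave_on_def intro: has_derivative_minus has_derivative_grad\<close>)
  then show ?thesis by simp
qed

text \<open>
  At a gradient both conjugates attain their optimum at the base point (equality in Fenchel's
  inequality); in particular they are finite there.
\<close>

lemma conjugate_grad:
  assumes "convex_on orthant f" and "f differentiable_on orthant" and "u \<in> orthant"
  shows "conjugate f (grad f u) = ereal (grad f u \<bullet> u - f u)"
  unfolding conjugate_def
proof (rule antisym)
  show "(SUP w\<in>orthant. ereal (grad f u \<bullet> w - f w)) \<le> ereal (grad f u \<bullet> u - f u)"
    using convex_above_grad[OF assms] by (intro SUP_least) (auto simp: inner_diff_right algebra_simps)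
qed (use assms in \<open>auto intro: SUP_upper\<close>)

lemma concave_conjugate_grad:
  assumes "concave_on orthant v" and "v differentiable_on orthant" and "u \<in> orthant"
  shows "concave_conjugate v (grad v u) = ereal (grad v u \<bullet> u - v u)"
  unfolding concave_conjugate_def
proof (rule antisym)
  show "ereal (grad v u \<bullet> u - v u) \<le> (INF w\<in>orthant. ereal (grad v u \<bullet> w - v w))"
    using concave_below_grad[OF assms] by (intro INF_greatest) (auto simp: inner_diff_right algebra_simps)
qed (use assms in \<open>auto intro: INF_lower\<close>)

lemma fenchel_inequality: "u \<in> orthant \<Longrightarrow> ereal (l \<bullet> u - f u) \<le> conjugate f l"
  unfolding conjugate_def by (rule SUP_upper)

section \<open>Welfare bounds from posted prices\<close>

lemma sum_in_orthant: "(\<And>t. t \<in> A \<Longrightarrow> x t \<in> {0..1}) \<Longrightarrow> (\<Sum>t\<in>A. x t) \<in> orthant"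
  by (simp add: orthant_def sum_nonneg)

text \<open>
  Each increment of the cost is at most the new marginal price times the new bundle, because the
  price is the slope at the right end of the increment; the increments telescope.
\<close>

lemma cost_le_marginal_revenue:
  fixes f :: "real ^ 'd \<Rightarrow> real" and n :: nat
  assumes "convex_on orthant f" and "f differentiable_on orthant" and "f 0 = 0"
    and x: "\<And>t. t \<in> {1..n} \<Longrightarrow> x t \<in> {0..1}"
  shows "f (\<Sum>t=1..n. x t) \<le> (\<Sum>t=1..n. grad f (\<Sum>i=1..t. x i) \<bullet> x t)"
  using x
proof (induction n)
  case 0
  then show ?case using assms(3) by simp
next
  case (Suc n)
  have "f (\<Sum>t=1..Suc n. x t) + grad f (\<Sum>t=1..Suc n. x t) \<bullet> ((\<Sum>t=1..n. x t) - (\<Sum>t=1..Suc n. x t))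
      \<le> f (\<Sum>t=1..n. x t)"
    by (intro convex_above_grad assms(1,2) sum_in_orthant Suc.prems) auto
  with Suc show ?case by simp
qed

text \<open>
  In the variable \<open>x\<close> the Lagrangian is \<open>(z - l) \<bullet> x\<close> plus terms that are constant, and these
  constants are finite at the prices used by the algorithm since they are gradients.
\<close>

lemma simultaneous_update_best_response:
  fixes f\<^sub>s :: "real ^ 'd \<Rightarrow> real"
  assumes fs: "procurement_cost f\<^sub>s"
    and v: "\<forall>t\<in>{1..T}. payment_function (v t)"
    and su: "simultaneous_update T f\<^sub>s v l z x"
    and t: "t \<in> {1..T}"
  shows "x t \<in> {0..1}" and "y \<in> {0..1} \<Longrightarrow> (z t - l t) \<bullet> y \<le> (z t - l t) \<bullet> x t"
proof -
  have x: "x i \<in> {0..1}" if "i \<in> {1..T}" for i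
    using su that unfolding simultaneous_update_def saddle_point_def by blast
  then show "x t \<in> {0..1}" using t .
  assume y: "y \<in> {0..1}"
  let ?s = "\<Sum>i=1..<t. x i"
  have "su_lagrangian f\<^sub>s (v t) ?s (l t, z t) y \<le> su_lagrangian f\<^sub>s (v t) ?s (l t, z t) (x t)"
    using su t y unfolding simultaneous_update_def saddle_point_def by blast
  moreover have "\<exists>c. conjugate f\<^sub>s (l t) = ereal c"
  proof -
    have "(\<Sum>i=1..t. x i) \<in> orthant" using x t by (intro sum_in_orthant) auto
    then show ?thesis
      using conjugate_grad[of f\<^sub>s] fs su t
      unfolding simultaneous_update_def procurement_cost_def by auto
  qed
  moreover have "\<exists>c. concave_conjugate (v t) (z t) = ereal c"
  proof -
    have "x t \<in> orthant" using x[OF t] by (simp add: orthant_def)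
    then show ?thesis
      using concave_conjugate_grad[of "v t"] bspec[OF v t] su t
      unfolding simultaneous_update_def payment_function_def by auto
  qed
  ultimately show "(z t - l t) \<bullet> y \<le> (z t - l t) \<bullet> x t"
    by (auto simp: su_lagrangian_def inner_diff_left inner_add_right)
qed

text \<open>
  Concavity and \<open>v t 0 = 0\<close> give \<open>v t (x t) \<ge> z t \<bullet> x t\<close>, and \<open>z t \<bullet> x t \<ge> l t \<bullet> x t\<close> because
  buying nothing is a possible response to the price \<open>l t\<close>.
\<close>

lemma surrogate_welfare_nonneg:
  fixes f\<^sub>s :: "real ^ 'd \<Rightarrow> real"
  assumes fs: "procurement_cost f\<^sub>s"
    and v: "\<forall>t\<in>{1..T}. payment_function (v t)"
    and su: "simultaneous_update T f\<^sub>s v l z x"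
  shows "0 \<le> welfare T v f\<^sub>s x"
proof -
  note x = simultaneous_update_best_response(1)[OF fs v su]
  have l: "l t = grad f\<^sub>s (\<Sum>i=1..t. x i)" and z: "z t = grad (v t) (x t)" if "t \<in> {1..T}" for t
    using su that unfolding simultaneous_update_def by blast+
  have "f\<^sub>s (\<Sum>t=1..T. x t) \<le> (\<Sum>t=1..T. l t \<bullet> x t)"
    using cost_le_marginal_revenue[of f\<^sub>s T x] fs x l by (simp add: procurement_cost_def)
  also have "\<dots> \<le> (\<Sum>t=1..T. v t (x t))"
  proof (rule sum_mono)
    fix t assume t: "t \<in> {1..T}"
    have "x t \<in> orthant" "0 \<in> orthant" using x[OF t] by (auto simp: orthant_def)
    then have "z t \<bullet> x t \<le> v t (x t)"
      using concave_below_grad[of "v t" "x t" 0] bspec[OF v t] z[OF t] by (simp add: payment_function_def)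
    moreover have "(0 :: real ^ 'd) \<in> {0..1}" by (simp add: less_eq_vec_def)
    then have "0 \<le> (z t - l t) \<bullet> x t"
      using simultaneous_update_best_response(2)[OF fs v su t] by fastforce
    ultimately show "l t \<bullet> x t \<le> v t (x t)" by (simp add: inner_diff_left)
  qed
  finally show ?thesis by (simp add: welfare_def)
qed

text \<open>
  Weak duality at the final price \<open>\<lambda> = \<nabla>f\<^sub>s U\<close>: the payments of \<open>y\<close> lie below their
  linearisations at \<open>x\<close>, and \<open>(z t - \<lambda>) \<bullet> y t \<le> (z t - l t) \<bullet> y t \<le> (z t - l t) \<bullet> x t\<close>
  because \<open>y t \<ge> 0\<close>, \<open>l t \<le> \<lambda>\<close>, and \<open>x t\<close> is a best response.
\<close>

lemma welfare_le_surrogate_welfare_plus_conjugate: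
  fixes f f\<^sub>s :: "real ^ 'd \<Rightarrow> real"
  assumes fs: "procurement_cost f\<^sub>s"
    and v: "\<forall>t\<in>{1..T}. payment_function (v t)"
    and su: "simultaneous_update T f\<^sub>s v l z x"
    and y: "\<And>t. t \<in> {1..T} \<Longrightarrow> y t \<in> {0..1}"
  shows "ereal (welfare T v f y)
    \<le> ereal (welfare T v f\<^sub>s x) + conjugate f (grad f\<^sub>s (\<Sum>t=1..T. x t))"
proof -
  note x = simultaneous_update_best_response(1)[OF fs v su]
  have l: "l t = grad f\<^sub>s (\<Sum>i=1..t. x i)" and z: "z t = grad (v t) (x t)" if "t \<in> {1..T}" for t
    using su that unfolding simultaneous_update_def by blast+
  define L where "L = grad f\<^sub>s (\<Sum>t=1..T. x t)"
  have step: "v t (y t) - L \<bullet> y t \<le> v t (x t) - l t \<bullet> x t" if t: "t \<in> {1..T}" for t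
  proof -
    have "(\<Sum>i=1..t. x i) \<le> (\<Sum>i=1..T. x i)"
      using t x by (intro sum_mono2) auto
    moreover have "(\<Sum>i=1..t. x i) \<in> orthant" "(\<Sum>i=1..T. x i) \<in> orthant"
      using t x by (auto intro!: sum_in_orthant)
    ultimately have "l t \<le> L"
      using fs l[OF t] by (simp add: L_def procurement_cost_def)
    then have "l t \<bullet> y t \<le> L \<bullet> y t"
      using y[OF t] by (auto simp: inner_vec_def less_eq_vec_def intro!: sum_mono mult_right_mono)
    moreover have "(z t - l t) \<bullet> y t \<le> (z t - l t) \<bullet> x t"
      by (rule simultaneous_update_best_response(2)[OF fs v su t y[OF t]])
    moreover have "x t \<in> orthant" "y t \<in> orthant" using x[OF t] y[OF t] by (auto simp: orthant_def)
    then have "v t (y t) \<le> v t (x t) + z t \<bullet> (y t - x t)"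
      using concave_below_grad[of "v t" "x t" "y t"] bspec[OF v t] z[OF t] by (simp add: payment_function_def)
    ultimately show ?thesis by (simp add: inner_diff_left inner_diff_right)
  qed
  have "f\<^sub>s (\<Sum>t=1..T. x t) \<le> (\<Sum>t=1..T. l t \<bullet> x t)"
    using cost_le_marginal_revenue[of f\<^sub>s T x] fs x l by (simp add: procurement_cost_def)
  moreover have "(\<Sum>t=1..T. v t (y t)) - L \<bullet> (\<Sum>t=1..T. y t)
      \<le> (\<Sum>t=1..T. v t (x t)) - (\<Sum>t=1..T. l t \<bullet> x t)"
    using sum_mono[of "{1..T}", OF step] by (simp add: sum_subtractf inner_sum_right)
  ultimately have "welfare T v f y
      \<le> welfare T v f\<^sub>s x + (L \<bullet> (\<Sum>t=1..T. y t) - f (\<Sum>t=1..T. y t))"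
    by (simp add: welfare_def)
  then have "ereal (welfare T v f y)
      \<le> ereal (welfare T v f\<^sub>s x) + ereal (L \<bullet> (\<Sum>t=1..T. y t) - f (\<Sum>t=1..T. y t))"
    by simp
  also have "\<dots> \<le> ereal (welfare T v f\<^sub>s x) + conjugate f L"
    using y by (intro add_left_mono fenchel_inequality sum_in_orthant) auto
  finally show ?thesis by (simp add: L_def)
qed

section \<open>The competitive ratio\<close>

lemma conjugate_nonneg: "f 0 = 0 \<Longrightarrow> 0 \<le> conjugate f l"
  using fenchel_inequality[of 0 l f] by (simp add: orthant_def zero_ereal_def)

text \<open>
  At \<open>u = 0\<close> the denominator vanishes and the numerator is nonnegative, so the conventions for
  division by zero make the ratio \<open>1\<close> or \<open>\<infinity>\<close>.
\<close>

lemma alpha_ge_1: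
  fixes f f\<^sub>s :: "real ^ 'd \<Rightarrow> real"
  assumes "f 0 = 0" and "f\<^sub>s 0 = 0"
  shows "1 \<le> alpha T f f\<^sub>s"
proof -
  have "0 \<in> {0..real T *\<^sub>R (1 :: real ^ 'd)}" by (simp add: less_eq_vec_def)
  then have "ratio (conjugate f (grad f\<^sub>s 0)) (ereal (f\<^sub>s 0 - f 0)) \<le> alpha T f f\<^sub>s"
    unfolding alpha_def by (rule SUP_upper)
  moreover have "1 \<le> ratio (conjugate f (grad f\<^sub>s 0)) (ereal (f\<^sub>s 0 - f 0))"
    using conjugate_nonneg[of f "grad f\<^sub>s 0"] assms
    by (cases "conjugate f (grad f\<^sub>s 0) = 0") (auto simp: ratio_conventions zero_ereal_def[symmetric])
  ultimately show ?thesis by (rule order_trans[rotated])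
qed

text \<open>
  Clearing the denominator: where \<open>f\<^sub>s u = f u\<close>, finiteness of \<open>\<alpha>\<close> forces the conjugate to
  vanish as well.
\<close>

lemma conjugate_grad_le_alpha:
  assumes "f 0 = 0" and u: "u \<in> {0..real T *\<^sub>R 1}" and le: "f u \<le> f\<^sub>s u"
    and a: "alpha T f f\<^sub>s = ereal a"
  shows "conjugate f (grad f\<^sub>s u) \<le> ereal (a * (f\<^sub>s u - f u))"
proof -
  let ?c = "conjugate f (grad f\<^sub>s u)"
  have r: "ratio ?c (ereal (f\<^sub>s u - f u)) \<le> ereal a"
    unfolding a[symmetric] alpha_def using u by (rule SUP_upper)
  have c: "0 \<le> ?c" using assms(1) by (rule conjugate_nonneg)
  show ?thesis
  proof (cases "f\<^sub>s u = f u")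
    case True
    then have "?c = 0"
      using r c ratio_conventions(2)[of ?c] by (cases "?c = 0") (auto simp: zero_ereal_def[symmetric])
    with True show ?thesis by simp
  next
    case False
    then have pos: "0 < f\<^sub>s u - f u" using le by simp
    then have "?c / ereal (f\<^sub>s u - f u) \<le> ereal a"
      using r by (simp add: ratio_def)
    with pos show ?thesis
      by (cases ?c) (auto simp: field_simps)
  qed
qed

theorem theorem4p1:
  fixes T :: nat and f f\<^sub>s :: "real ^ 'd \<Rightarrow> real"
    and v :: "nat \<Rightarrow> real ^ 'd \<Rightarrow> real"
    and l z x :: "nat \<Rightarrow> real ^ 'd"
  assumes "T \<ge> 1"
    and "procurement_cost f"
    and "surrogate T f f\<^sub>s"
    and "\<And>t. t \<in> {1..T} \<Longrightarrow> payment_function (v t)"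
    and "simultaneous_update T f\<^sub>s v l z x"
  shows "ereal ((\<Sum>t=1..T. v t (x t)) - f (\<Sum>t=1..T. x t))
           \<ge> 1 / alpha T f f\<^sub>s * offline_opt T v f"
proof -
  have v: "\<forall>t\<in>{1..T}. payment_function (v t)" using assms(4) by blast
  define U where "U = (\<Sum>t=1..T. x t)"
  have fs: "procurement_cost f\<^sub>s" and zero: "f 0 = 0" "f\<^sub>s 0 = 0"
    using assms(2,3) by (auto simp: surrogate_def procurement_cost_def)
  have x: "x t \<in> {0..1}" if "t \<in> {1..T}" for t
    using simultaneous_update_best_response(1)[OF fs v assms(5) that] .
  have "U \<le> (\<Sum>t=1..T. 1)" unfolding U_def using x by (intro sum_mono) auto
  then have U: "U \<in> {0..real T *\<^sub>R 1}"
    using x by (auto simp: U_def sum_constant_scaleR simp del: sum_constant intro!: sum_nonneg)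
  then have le: "f U \<le> f\<^sub>s U" using assms(3) by (auto simp: surrogate_def)
  have B: "0 \<le> welfare T v f\<^sub>s x" by (rule surrogate_welfare_nonneg[OF fs v assms(5)])
  have A: "welfare T v f x = welfare T v f\<^sub>s x + (f\<^sub>s U - f U)" by (simp add: welfare_def U_def)
  have "1 / alpha T f f\<^sub>s * offline_opt T v f \<le> ereal (welfare T v f x)"
  proof (cases "alpha T f f\<^sub>s")
    case (real a)
    with alpha_ge_1[where f = f and f\<^sub>s = f\<^sub>s, OF zero, of T]
    have a: "1 \<le> a" by (simp add: one_ereal_def)
    obtain y where y: "\<And>t. t \<in> {1..T} \<Longrightarrow> y t \<in> {0..1}"
      and opt: "offline_opt T v f = ereal (welfare T v f y)"
      using offline_opt_attained[of T v f] assms(2,4) by blast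
    have "ereal (welfare T v f y) \<le> ereal (welfare T v f\<^sub>s x) + conjugate f (grad f\<^sub>s U)"
      unfolding U_def by (rule welfare_le_surrogate_welfare_plus_conjugate[OF fs v assms(5) y])
    also have "\<dots> \<le> ereal (welfare T v f\<^sub>s x) + ereal (a * (f\<^sub>s U - f U))"
      by (intro add_left_mono conjugate_grad_le_alpha[where T = T] zero(1) U le real)
    finally have "welfare T v f y \<le> welfare T v f\<^sub>s x + a * (f\<^sub>s U - f U)" by simp
    also have "\<dots> \<le> a * welfare T v f x"
      using mult_right_mono[OF a B] by (simp add: A algebra_simps)
    finally show ?thesis using a by (simp add: real opt one_ereal_def field_simps)
  next
    \<comment> \<open>For \<open>\<alpha> = \<infinity>\<close> the claim is that the welfare is nonnegative.\<close>
    case PInf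
    then show ?thesis using A B le by simp
  next
    case MInf
    then show ?thesis using alpha_ge_1[where f = f and f\<^sub>s = f\<^sub>s, OF zero, of T] by simp
  qed
  then show ?thesis by (simp add: welfare_def)
qed

end
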